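(* Let $n \geq 2$ and $H \geq 2$ be integers, and let $m_{i,h} \in \mathbf{Z}$ for all $i = 1,\ldots,n-1$ and $h = 1,\ldots,H$. For every real number $\theta > 0$ there exist Lebesgue-measurable sets of real numbers $A_1,\ldots,A_n$ such that \[ \mu(hA_i) - \mu(hA_{i+1}) = \theta\, m_{i,h} \] for all $i = 1,\ldots,n-1$ and $h = 1,\ldots,H$.
   Context: $\mu$ denotes Lebesgue measure on $\mathbf{R}$. For $A \subseteq \mathbf{R}$ and a positive integer $h$, $hA = \{a_1+\cdots+a_h : a_i \in A \text{ for all } i\}$ is the $h$-fold sumset. *)

theory Defs
  imports "HOL-Analysis.Analysis"
begin

definition hfold_sumset :: "nat \<Rightarrow> real set \<Rightarrow> real set" where
  "hfold_sumset h A = {(\<Sum>j<h. a j) | a. \<forall>j<h. a j \<in> A}"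

end

theory Submission
  imports Defs
begin

text \<open>
  Start from \<open>{0}\<close> and adjoin intervals \<open>[l, s]\<close> on rapidly growing scales.  If \<open>A \<subseteq> [0, t]\<close>
  contains \<open>0\<close> and \<open>t\<close>, and \<open>s - l \<ge> t\<close>, then \<open>h(A \<union> [l, s])\<close> is the union of \<open>hA\<close> and the intervals
  \<open>[j l, j s + (h - j) t]\<close> for \<open>1 \<le> j \<le> h\<close>, so the new interval contributes to the measure of the
  \<open>h\<close>-fold sumset an amount that does not depend on the structure of \<open>A\<close>.
  Taking \<open>s = (2k + 1) R\<close> and \<open>l = (2k - 1) R - u\<close> with \<open>R\<close> large compared to \<open>u\<close> and \<open>t\<close>, the first
  \<open>k\<close> of these intervals are separated by gaps and the later ones overlap, so the contribution is
  a constant plus \<open>u\<close> times \<open>1 + 2 + \<dots> + min h k\<close>.  The vectors \<open>(1 + \<dots> + min h k)\<^sub>h\<close>, for \<open>k = 1, \<dots>, H\<close>,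
  form a basis of \<open>H\<close>-dimensional space.  Hence suitable parameters \<open>u\<close>, one for each \<open>k\<close>, shift the vector
  of measures by any prescribed amount, all sets sharing the same constant part.
\<close>

section \<open>Sumsets, and how adjoining an interval changes them\<close>

lemma hfold_sumset_add:
  assumes "x \<in> hfold_sumset p A" "y \<in> hfold_sumset q A"
  shows "x + y \<in> hfold_sumset (p + q) A"
proof -
  obtain a where a: "x = (\<Sum>j<p. a j)" "\<forall>j<p. a j \<in> A"
    using assms(1) by (auto simp: hfold_sumset_def)
  obtain b where b: "y = (\<Sum>j<q. b j)" "\<forall>j<q. b j \<in> A"
    using assms(2) by (auto simp: hfold_sumset_def)
  define c where "c j = (if j < p then a j else b (j - p))" for j
  have "(\<Sum>j<p + q. c j) = (\<Sum>j<p. c j) + (\<Sum>j<q. c (p + j))"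
    by (induction q) auto
  also have "\<dots> = x + y"
    by (simp add: a b c_def)
  finally have "x + y = (\<Sum>j<p + q. c j)" by simp
  moreover have "\<forall>j<p + q. c j \<in> A"
    using a b by (auto simp: c_def)
  ultimately show ?thesis
    by (auto simp: hfold_sumset_def)
qed

lemma of_nat_mult_in_hfold_sumset: "c \<in> A \<Longrightarrow> real p * c \<in> hfold_sumset p A"
  by (auto simp: hfold_sumset_def intro!: exI[of _ "\<lambda>_. c"])

lemma hfold_sumset_mono: "A \<subseteq> B \<Longrightarrow> hfold_sumset h A \<subseteq> hfold_sumset h B"
  by (auto simp: hfold_sumset_def)

lemma hfold_sumset_one: "hfold_sumset 1 A = A"
  by (auto simp: hfold_sumset_def)

lemma hfold_sumset_subset_Icc:
  assumes "A \<subseteq> {0..t}"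
  shows "hfold_sumset h A \<subseteq> {0..real h * t}"
proof
  fix x assume "x \<in> hfold_sumset h A"
  then obtain a where a: "x = (\<Sum>j<h. a j)" "\<And>j. j < h \<Longrightarrow> 0 \<le> a j \<and> a j \<le> t"
    using assms by (force simp: hfold_sumset_def)
  have "0 \<le> x" unfolding a(1) using a(2) by (intro sum_nonneg) auto
  moreover have "x \<le> real (card {..<h}) * t"
    unfolding a(1) using a(2) by (intro sum_bounded_above) auto
  ultimately show "x \<in> {0..real h * t}" by simp
qed

lemma hfold_sumset_zero_singleton: "hfold_sumset h {0} = {0}"
  using hfold_sumset_subset_Icc[of "{0}" 0 h] of_nat_mult_in_hfold_sumset[of 0 "{0}" h] by auto

text \<open>Let j be the number of summands outside \<open>A\<close>: these lie in [l, s] and the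
  other h - j lie in [0, t], which gives one inclusion. The converse needs only the elements 0 and t
  of \<open>A\<close>: for j >= 1 the interval [j l, j s] has length at least t, so its translates
  by 0, t, ..., (h - j) t leave no holes.\<close>

lemma hfold_sumset_Un_Icc:
  assumes A: "A \<subseteq> {0..t}" "0 \<in> A" "t \<in> A" and st: "t \<le> s - l"
  shows "hfold_sumset h (A \<union> {l..s}) =
    hfold_sumset h A \<union> (\<Union>j\<in>{1..h}. {real j * l..real j * s + real (h - j) * t})"
    (is "?L = _ \<union> ?R")
proof (intro equalityI subsetI)
  fix x assume "x \<in> ?L"
  then obtain a where a: "x = (\<Sum>j<h. a j)" "\<And>j. j < h \<Longrightarrow> a j \<in> A \<union> {l..s}"
    by (auto simp: hfold_sumset_def)
  define J where "J = {j\<in>{..<h}. a j \<notin> A}"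
  have J: "J \<subseteq> {..<h}" "finite J" by (auto simp: J_def)
  have cJ: "card J \<le> h" using card_mono[OF _ J(1)] by simp
  show "x \<in> hfold_sumset h A \<union> ?R"
  proof (cases "J = {}")
    case True
    then have "x \<in> hfold_sumset h A" by (auto simp: hfold_sumset_def J_def a(1))
    then show ?thesis by blast
  next
    case False
    have split: "x = sum a J + sum a ({..<h} - J)"
      unfolding a(1) using J by (simp add: sum.subset_diff add.commute)
    have inJ: "l \<le> a j \<and> a j \<le> s" if "j \<in> J" for j
      using that a(2)[of j] by (auto simp: J_def)
    have outJ: "0 \<le> a j \<and> a j \<le> t" if "j \<in> {..<h} - J" for j
      using that A(1) by (auto simp: J_def)
    have "real (card J) * l \<le> sum a J" "sum a J \<le> real (card J) * s"
      using inJ by (auto intro!: sum_bounded_below sum_bounded_above)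
    moreover have "0 \<le> sum a ({..<h} - J)"
      using outJ by (intro sum_nonneg) auto
    moreover have "sum a ({..<h} - J) \<le> real (card ({..<h} - J)) * t"
      using outJ by (intro sum_bounded_above) auto
    moreover have "card ({..<h} - J) = h - card J"
      using J by (simp add: card_Diff_subset)
    ultimately have "x \<in> {real (card J) * l..real (card J) * s + real (h - card J) * t}"
      using split by auto
    moreover have "card J \<in> {1..h}"
      using cJ False J by (auto simp: Suc_le_eq card_gt_0_iff)
    ultimately show ?thesis by blast
  qed
next
  fix x assume "x \<in> hfold_sumset h A \<union> ?R"
  then show "x \<in> ?L"
  proof
    assume "x \<in> hfold_sumset h A"
    then show ?thesis using hfold_sumset_mono[of A "A \<union> {l..s}"] by blast
  next
    assume "x \<in> ?R"
    then obtain j where j: "1 \<le> j" "j \<le> h" "real j * l \<le> x" "x \<le> real j * s + real (h - j) * t"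
      by auto
    have t0: "0 \<le> t" using A by auto
    have jst: "t \<le> real j * s - real j * l"
    proof -
      have "1 * t \<le> real j * (s - l)" using j st t0 by (intro mult_mono) auto
      then show ?thesis by (simp add: algebra_simps)
    qed
    \<comment> \<open>Here q counts the summands equal to t. If p copies do not suffice, then x > j
      s + p t, and subtracting p + 1 copies lands in [j l, j s] by \<open>jst\<close>.\<close>
    have "\<exists>q\<le>p. real j * l \<le> x - real q * t \<and> x - real q * t \<le> real j * s"
      if "x \<le> real j * s + real p * t" for p
      using that
    proof (induction p)
      case 0
      then show ?case using j by simp
    next
      case (Suc p)
      show ?case
      proof (cases "x \<le> real j * s + real p * t")
        case True
        then show ?thesis using Suc.IH le_Suc_eq by blast
      next
        case False
        then show ?thesis using Suc.prems jst
          by (intro exI[of _ "Suc p"]) (auto simp: algebra_simps)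
      qed
    qed
    then obtain q where q: "q \<le> h - j" "real j * l \<le> x - real q * t" "x - real q * t \<le> real j * s"
      using j(4) by blast
    let ?B = "A \<union> {l..s}"
    \<comment> \<open>So x is the sum of j equal summands from [l, s], q copies of t and h - j - q
      zeros.\<close>
    have "(x - real q * t) / real j \<in> ?B"
      using q j by (auto simp: field_simps)
    from of_nat_mult_in_hfold_sumset[OF this, of j] have "x - real q * t \<in> hfold_sumset j ?B"
      using j by simp
    moreover have "real q * t \<in> hfold_sumset q ?B"
      using A by (intro of_nat_mult_in_hfold_sumset) auto
    moreover have "real (h - j - q) * 0 \<in> hfold_sumset (h - j - q) ?B"
      using A by (intro of_nat_mult_in_hfold_sumset) auto
    ultimately have "(x - real q * t) + real q * t + real (h - j - q) * 0
        \<in> hfold_sumset (j + q + (h - j - q)) ?B"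
      by (intro hfold_sumset_add)
    then show ?thesis using q j by simp
  qed
qed

section \<open>Measures of finite unions of intervals\<close>

lemma lmeasurable_Icc: "{a..b::real} \<in> lmeasurable"
  using lmeasurable_cbox[of a b] by simp

lemma lmeasurable_UN_Icc: "finite I \<Longrightarrow> (\<Union>j\<in>I. {\<alpha> j..\<beta> j::real}) \<in> lmeasurable"
  by (intro fmeasurable.finite_UN) (auto simp: lmeasurable_Icc)

lemma measure_UN_separated_Icc:
  fixes \<alpha> \<beta> :: "nat \<Rightarrow> real"
  assumes "\<And>j. j \<in> {1..p} \<Longrightarrow> \<alpha> j \<le> \<beta> j" "\<And>j. j \<in> {1..<p} \<Longrightarrow> \<beta> j < \<alpha> (Suc j)"
  shows "measure lebesgue (\<Union>j\<in>{1..p}. {\<alpha> j..\<beta> j}) = (\<Sum>j=1..p. \<beta> j - \<alpha> j)"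
  using assms
proof (induction p)
  case 0
  then show ?case by simp
next
  case (Suc p)
  let ?U = "\<Union>j\<in>{1..p}. {\<alpha> j..\<beta> j}" and ?I = "{\<alpha> (Suc p)..\<beta> (Suc p)}"
  have IH: "measure lebesgue ?U = (\<Sum>j=1..p. \<beta> j - \<alpha> j)"
    using Suc.prems by (intro Suc.IH) auto
  have below: "\<beta> j < \<alpha> (Suc p)" if "1 \<le> j" "j \<le> p" for j
    using that(2)
  proof (induction rule: inc_induct)
    case base
    then show ?case using that Suc.prems(2)[of p] by simp
  next
    case (step i)
    then show ?case
      using that Suc.prems(2)[of i] Suc.prems(1)[of "Suc i"] by simp
  qed
  have disj: "?U \<inter> ?I = {}"
    using below by fastforce
  have "(\<Union>j\<in>{1..Suc p}. {\<alpha> j..\<beta> j}) = ?U \<union> ?I"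
    by (auto simp: atLeastAtMostSuc_conv)
  also have "measure lebesgue \<dots> = measure lebesgue ?U + measure lebesgue ?I"
    by (intro measure_Un_AE lmeasurable_UN_Icc lmeasurable_Icc AE_I2) (use disj in blast, simp)
  finally show ?case using IH Suc.prems(1)[of "Suc p"] by simp
qed

lemma UN_overlapping_Icc:
  fixes \<alpha> \<beta> :: "nat \<Rightarrow> real"
  assumes "p \<le> h"
    and "\<And>j. j \<in> {p..<h} \<Longrightarrow> \<alpha> (Suc j) \<le> \<beta> j \<and> \<alpha> j \<le> \<alpha> (Suc j) \<and> \<beta> j \<le> \<beta> (Suc j)"
  shows "(\<Union>j\<in>{p..h}. {\<alpha> j..\<beta> j}) = {\<alpha> p..\<beta> h}"
proof -
  \<comment> \<open>The first conjunct strengthens the induction: it keeps the next interval from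
    extending the union to the left.\<close>
  have "\<alpha> p \<le> \<alpha> h \<and> (\<Union>j\<in>{p..h}. {\<alpha> j..\<beta> j}) = {\<alpha> p..\<beta> h}"
    using assms
  proof (induction h rule: dec_induct)
    case base
    then show ?case by simp
  next
    case (step h)
    then have IH: "\<alpha> p \<le> \<alpha> h" "(\<Union>j\<in>{p..h}. {\<alpha> j..\<beta> j}) = {\<alpha> p..\<beta> h}"
      by auto
    have "{p..Suc h} = insert (Suc h) {p..h}"
      using step.hyps by auto
    then have "(\<Union>j\<in>{p..Suc h}. {\<alpha> j..\<beta> j}) = {\<alpha> (Suc h)..\<beta> (Suc h)} \<union> {\<alpha> p..\<beta> h}"
      by (simp only: UN_insert IH(2))
    moreover have "\<alpha> (Suc h) \<le> \<beta> h" "\<alpha> h \<le> \<alpha> (Suc h)" "\<beta> h \<le> \<beta> (Suc h)"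
      using step.prems[of h] step.hyps by auto
    ultimately show ?case using IH(1) by auto
  qed
  then show ?thesis ..
qed

text \<open>The intervals from index p on merge into one block from \<alpha> p to \<beta> h.
  Replacing the right end \<beta> p by \<beta> h therefore leaves p separated intervals with the
  same union, whose lengths add up.\<close>

lemma measure_UN_Icc_gaps_then_overlaps:
  fixes \<alpha> \<beta> :: "nat \<Rightarrow> real"
  assumes "1 \<le> p" "p \<le> h"
    and le: "\<And>j. j \<in> {1..h} \<Longrightarrow> \<alpha> j \<le> \<beta> j"
    and gap: "\<And>j. j \<in> {1..<p} \<Longrightarrow> \<beta> j < \<alpha> (Suc j)"
    and overlap: "\<And>j. j \<in> {p..<h} \<Longrightarrow> \<alpha> (Suc j) \<le> \<beta> j \<and> \<alpha> j \<le> \<alpha> (Suc j) \<and> \<beta> j \<le> \<beta> (Suc j)"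
  shows "measure lebesgue (\<Union>j\<in>{1..h}. {\<alpha> j..\<beta> j}) = (\<Sum>j=1..<p. \<beta> j) + \<beta> h - (\<Sum>j=1..p. \<alpha> j)"
proof -
  define \<gamma> where "\<gamma> j = (if j = p then \<beta> h else \<beta> j)" for j
  have merged: "(\<Union>j\<in>{p..h}. {\<alpha> j..\<beta> j}) = {\<alpha> p..\<beta> h}"
    using assms(2) overlap by (rule UN_overlapping_Icc)
  have p: "p \<in> {p..h}" "p \<in> {1..h}" using assms by auto
  have ne: "\<alpha> p \<le> \<beta> h"
  proof -
    have "\<alpha> p \<in> (\<Union>j\<in>{p..h}. {\<alpha> j..\<beta> j})" using le[OF p(2)] p(1) by fastforce
    then show ?thesis unfolding merged by simp
  qed
  have "{1..h} = {1..<p} \<union> {p..h}" using assms(1,2) by auto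
  then have "(\<Union>j\<in>{1..h}. {\<alpha> j..\<beta> j}) = (\<Union>j\<in>{1..<p}. {\<alpha> j..\<beta> j}) \<union> (\<Union>j\<in>{p..h}. {\<alpha> j..\<beta> j})"
    by (simp only: UN_Un)
  also have "\<dots> = (\<Union>j\<in>{1..<p}. {\<alpha> j..\<gamma> j}) \<union> {\<alpha> p..\<gamma> p}"
    unfolding merged by (simp add: \<gamma>_def)
  also have "\<dots> = (\<Union>j\<in>{1..p}. {\<alpha> j..\<gamma> j})"
  proof -
    have "{1..p} = insert p {1..<p}" using assms(1) by auto
    then show ?thesis by (simp only: UN_insert Un_commute)
  qed
  also have "measure lebesgue \<dots> = (\<Sum>j=1..p. \<gamma> j - \<alpha> j)"
    using le gap ne assms(2) by (intro measure_UN_separated_Icc) (auto simp: \<gamma>_def)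
  also have "\<dots> = (\<Sum>j=1..p. \<gamma> j) - (\<Sum>j=1..p. \<alpha> j)"
    by (simp add: sum_subtractf)
  also have "(\<Sum>j=1..p. \<gamma> j) = (\<Sum>j=1..<p. \<gamma> j) + \<gamma> p"
    using assms(1) by (simp add: sum.last_plus add.commute)
  also have "(\<Sum>j=1..<p. \<gamma> j) = (\<Sum>j=1..<p. \<beta> j)"
    by (intro sum.cong) (auto simp: \<gamma>_def)
  finally show ?thesis by (simp add: \<gamma>_def)
qed

section \<open>The effect of adjoined intervals on the measures of the sumsets\<close>

definition tri :: "nat \<Rightarrow> real" where
  "tri p = (\<Sum>j=1..p. real j)"

text \<open>The parameter u is placed in l only. It thus enters the measure solely through the left
  ends j l of the first \<open>min h k\<close> intervals, with total coefficient
  \<open>tri (min h k)\<close>. The new intervals miss hA, which lies in [0, h t], because l > h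
  t.\<close>

lemma measure_hfold_sumset_Un_Icc:
  fixes k h :: nat and R t u U :: real
  defines "s \<equiv> real (2 * k + 1) * R" and "l \<equiv> real (2 * k - 1) * R - u"
  assumes A: "A \<subseteq> {0..t}" "0 \<in> A" "t \<in> A" and meas: "hfold_sumset h A \<in> lmeasurable"
    and k: "1 \<le> k" and h: "1 \<le> h"
    and u: "\<bar>u\<bar> \<le> U" and R: "real h * t + real (h + k + 1) * U < R"
  shows "hfold_sumset h (A \<union> {l..s}) \<in> lmeasurable"
    and "measure lebesgue (hfold_sumset h (A \<union> {l..s})) = measure lebesgue (hfold_sumset h A)
      + (\<Sum>j=1..<min h k. real j * s + real (h - j) * t) + real h * s
      - tri (min h k) * (real (2 * k - 1) * R) + u * tri (min h k)"
proof -
  define \<alpha> \<beta> where "\<alpha> j = real j * l" and "\<beta> j = real j * s + real (h - j) * t" for j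
  let ?V = "\<Union>j\<in>{1..h}. {\<alpha> j..\<beta> j}"
  have t0: "0 \<le> t" using A by auto
  have U0: "0 \<le> U" using u by auto
  have ht: "t \<le> real h * t" using h t0 by (simp add: mult_le_cancel_right1)
  have hU: "U \<le> real (h + k + 1) * U" using U0 by (simp add: mult_le_cancel_right1)
  have R0: "0 < R" using R ht hU t0 U0 by linarith
  have k1: "real (2 * k - 1) = 2 * real k - 1" using k by simp
  have sl: "s - l = 2 * R + u" unfolding s_def l_def k1 by (simp add: algebra_simps)
  have st: "t \<le> s - l" using sl R R0 ht hU u by linarith
  have "1 * R \<le> real (2 * k - 1) * R" using k R0 by (intro mult_right_mono) auto
  then have l_gt: "real h * t < l" unfolding l_def using R hU u by (simp; linarith)
  have l0: "0 < l" using l_gt t0 ht by linarith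
  have eq: "hfold_sumset h (A \<union> {l..s}) = hfold_sumset h A \<union> ?V"
    unfolding \<alpha>_def \<beta>_def by (rule hfold_sumset_Un_Icc[OF A st])
  have Vm: "?V \<in> lmeasurable" by (intro lmeasurable_UN_Icc) simp
  show "hfold_sumset h (A \<union> {l..s}) \<in> lmeasurable"
    unfolding eq using meas Vm by (rule fmeasurable.Un)
  have V_ge: "l \<le> x" if "x \<in> ?V" for x
  proof -
    obtain j where "1 \<le> j" "real j * l \<le> x" using \<open>x \<in> ?V\<close> by (auto simp: \<alpha>_def)
    moreover have "1 * l \<le> real j * l" using l0 \<open>1 \<le> j\<close> by (intro mult_right_mono) auto
    ultimately show ?thesis by linarith
  qed
  have disj: "hfold_sumset h A \<inter> ?V = {}"
    using hfold_sumset_subset_Icc[OF A(1), of h] V_ge l_gt by fastforce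
  have meas_eq: "measure lebesgue (hfold_sumset h (A \<union> {l..s})) =
      measure lebesgue (hfold_sumset h A) + measure lebesgue ?V"
    unfolding eq by (intro measure_Un_AE meas Vm AE_I2) (use disj in blast)
  \<comment> \<open>The coefficient of R is odd: at least 1 for j < k and at most -1 for j >= k. As
    R exceeds the terms in u and t together, it alone decides between gap and overlap.\<close>
  have diff: "\<alpha> (Suc j) - real j * s = (2 * real k - 1 - 2 * real j) * R - (real j + 1) * u" for j
    unfolding \<alpha>_def s_def l_def k1 by (simp add: algebra_simps)
  have ju: "\<bar>(real j + 1) * u\<bar> \<le> real (h + k + 1) * U" if "j \<le> h + k" for j
    unfolding abs_mult using that u U0 by (intro mult_mono) auto
  have "measure lebesgue ?V
      = (\<Sum>j=1..<min h k. \<beta> j) + \<beta> h - (\<Sum>j=1..min h k. \<alpha> j)"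
  proof (rule measure_UN_Icc_gaps_then_overlaps)
    show "1 \<le> min h k" "min h k \<le> h" using h k by auto
    show "\<alpha> j \<le> \<beta> j" if "j \<in> {1..h}" for j
    proof -
      have "real j * l \<le> real j * s" using st t0 by (intro mult_left_mono) auto
      then show ?thesis using t0 by (simp add: \<alpha>_def \<beta>_def add_increasing2)
    qed
    show "\<beta> j < \<alpha> (Suc j)" if "j \<in> {1..<min h k}" for j
    proof -
      have "1 * R \<le> (2 * real k - 1 - 2 * real j) * R"
        using that R0 by (intro mult_right_mono) auto
      moreover have "real (h - j) * t \<le> real h * t" using t0 by (intro mult_right_mono) auto
      moreover have "\<bar>(real j + 1) * u\<bar> \<le> real (h + k + 1) * U" using that by (intro ju) auto
      ultimately show ?thesis using diff[of j] R unfolding \<beta>_def by linarith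
    qed
    show "\<alpha> (Suc j) \<le> \<beta> j \<and> \<alpha> j \<le> \<alpha> (Suc j) \<and> \<beta> j \<le> \<beta> (Suc j)" if "j \<in> {min h k..<h}" for j
    proof (intro conjI)
      have "(2 * real k - 1 - 2 * real j) * R \<le> (- 1) * R"
        using that R0 by (intro mult_right_mono) auto
      moreover have "0 \<le> real (h - j) * t" "0 \<le> real h * t" using t0 by auto
      moreover have "\<bar>(real j + 1) * u\<bar> \<le> real (h + k + 1) * U" using that by (intro ju) auto
      ultimately show "\<alpha> (Suc j) \<le> \<beta> j" using diff[of j] R unfolding \<beta>_def by linarith
      show "\<alpha> j \<le> \<alpha> (Suc j)" using l0 by (simp add: \<alpha>_def algebra_simps)
      have "real (h - j) = real (h - Suc j) + 1" using that by auto
      then show "\<beta> j \<le> \<beta> (Suc j)" using st l0 by (simp add: \<beta>_def algebra_simps)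
    qed
  qed
  moreover have "(\<Sum>j=1..min h k. \<alpha> j) = tri (min h k) * (real (2 * k - 1) * R) - u * tri (min h k)"
    unfolding tri_def \<alpha>_def l_def sum_distrib_right[symmetric] by (simp only: right_diff_distrib mult.commute)
  ultimately show "measure lebesgue (hfold_sumset h (A \<union> {l..s})) = measure lebesgue (hfold_sumset h A)
      + (\<Sum>j=1..<min h k. real j * s + real (h - j) * t) + real h * s
      - tri (min h k) * (real (2 * k - 1) * R) + u * tri (min h k)"
    unfolding meas_eq by (simp add: \<beta>_def)
qed

text \<open>The order of quantifiers is the point: c and t are fixed before u, so sets built from
  different parameters share the constant part. The induction adjoins one interval for each k. The
  new maximum s does not depend on u, and the bound U allows one R for all admissible u.\<close>

lemma exists_sets_with_affine_sumset_measures: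
  fixes U :: real and H K :: nat
  assumes "0 \<le> U"
  shows "\<exists>c t. \<forall>u. (\<forall>k\<in>{1..K}. \<bar>u k\<bar> \<le> U) \<longrightarrow>
    (\<exists>A. A \<subseteq> {0..t} \<and> 0 \<in> A \<and> t \<in> A \<and>
      (\<forall>h\<in>{1..H}. hfold_sumset h A \<in> lmeasurable \<and>
        measure lebesgue (hfold_sumset h A) = c h + (\<Sum>k=1..K. u k * tri (min h k))))"
proof (induction K)
  case 0
  show ?case
    by (rule exI[of _ "\<lambda>_. 0"], rule exI[of _ 0], intro allI impI, rule exI[of _ "{0}"])
      (simp add: hfold_sumset_zero_singleton fmeasurableI_null_sets)
next
  case (Suc K)
  then obtain c t where ct: "\<And>u. (\<forall>k\<in>{1..K}. \<bar>u k\<bar> \<le> U) \<Longrightarrow>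
    (\<exists>A. A \<subseteq> {0..t} \<and> 0 \<in> A \<and> t \<in> A \<and>
      (\<forall>h\<in>{1..H}. hfold_sumset h A \<in> lmeasurable \<and>
        measure lebesgue (hfold_sumset h A) = c h + (\<Sum>k=1..K. u k * tri (min h k))))"
    by blast
  define k where "k = Suc K"
  have t0: "0 \<le> t" using ct[of "\<lambda>_. 0"] assms by auto
  \<comment> \<open>The factor \<open>Suc H\<close> instead of H gives t + U < R even for H = 0, and
    the final 1 makes the inequalities strict.\<close>
  define R where "R = real (Suc H) * t + real (H + k + 1) * U + 1"
  define s where "s = real (2 * k + 1) * R"
  define c' where "c' h = c h + (\<Sum>j=1..<min h k. real j * s + real (h - j) * t) + real h * s
      - tri (min h k) * (real (2 * k - 1) * R)" for h
  have R: "real h * t + real (h + k + 1) * U < R" if "h \<le> H" for h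
  proof -
    have "real h * t \<le> real (Suc H) * t" using that t0 by (intro mult_right_mono) auto
    moreover have "real (h + k + 1) * U \<le> real (H + k + 1) * U"
      using that assms by (intro mult_right_mono) auto
    ultimately show ?thesis by (simp add: R_def)
  qed
  have "1 * t \<le> real (Suc H) * t" "1 * U \<le> real (H + k + 1) * U"
    using t0 assms by (intro mult_right_mono; simp)+
  then have tR: "t + U < R" by (simp add: R_def)
  have kR: "1 * R \<le> real (2 * k - 1) * R" "real (2 * k - 1) * R + 2 * R = s"
    using tR t0 assms by (auto simp: s_def k_def algebra_simps)
  show ?case
  proof (intro exI[of _ c'] exI[of _ s] allI impI)
    fix u :: "nat \<Rightarrow> real" assume u: "\<forall>k\<in>{1..Suc K}. \<bar>u k\<bar> \<le> U"
    then obtain A where A: "A \<subseteq> {0..t}" "0 \<in> A" "t \<in> A"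
      and Ah: "\<And>h. h \<in> {1..H} \<Longrightarrow> hfold_sumset h A \<in> lmeasurable \<and>
        measure lebesgue (hfold_sumset h A) = c h + (\<Sum>k=1..K. u k * tri (min h k))"
      using ct[of u] by auto
    have uk: "\<bar>u k\<bar> \<le> U" using u by (auto simp: k_def)
    define l where "l = real (2 * k - 1) * R - u k"
    have ls: "0 \<le> l" "l \<le> s" "t \<le> s"
      using kR tR uk t0 assms unfolding l_def by linarith+
    show "\<exists>A. A \<subseteq> {0..s} \<and> 0 \<in> A \<and> s \<in> A \<and>
      (\<forall>h\<in>{1..H}. hfold_sumset h A \<in> lmeasurable \<and>
        measure lebesgue (hfold_sumset h A) = c' h + (\<Sum>k=1..Suc K. u k * tri (min h k)))"
    proof (intro exI[of _ "A \<union> {l..s}"] conjI ballI)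
      show "A \<union> {l..s} \<subseteq> {0..s}" "0 \<in> A \<union> {l..s}" "s \<in> A \<union> {l..s}"
        using A ls by auto
      fix h assume h: "h \<in> {1..H}"
      have k1: "1 \<le> k" by (simp add: k_def)
      have h1: "1 \<le> h" "h \<le> H" using h by auto
      note step = measure_hfold_sumset_Un_Icc[OF A conjunct1[OF Ah[OF h]] k1 h1(1) uk R[OF h1(2)],
          folded s_def l_def]
      show "hfold_sumset h (A \<union> {l..s}) \<in> lmeasurable" by (rule step(1))
      show "measure lebesgue (hfold_sumset h (A \<union> {l..s})) =
          c' h + (\<Sum>k=1..Suc K. u k * tri (min h k))"
        unfolding step(2) using Ah[OF h] by (simp add: c'_def k_def)
    qed
  qed
qed

section \<open>Solving the linear system for the parameters\<close>

lemma tri_min_diff: "tri (min h (Suc k)) - tri (min h k) = (if Suc k \<le> h then real (Suc k) else 0)"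
  by (auto simp: tri_def min_def le_Suc_eq)

text \<open>With u k = D k - D (k + 1), summation by parts moves the difference onto
  \<open>tri (min h k)\<close>, whose increments are k up to h and 0 afterwards. The system becomes:
  the sum of k * D k over k = 1, ..., h equals f h, which is solved by differences of f.\<close>

lemma tri_min_span:
  fixes f :: "nat \<Rightarrow> real"
  shows "\<exists>u. \<forall>h\<in>{1..H}. (\<Sum>k=1..H. u k * tri (min h k)) = f h"
proof -
  \<comment> \<open>The value 0 at k = 0 starts the telescoping sum. Cutting D off beyond H removes
    the boundary term of the summation by parts.\<close>
  define F where "F k = (if k = 0 then 0 else f k)" for k
  define D where "D k = (if k \<le> H then (F k - F (k - 1)) / real k else 0)" for k
  have parts: "(\<Sum>k=1..n. (D k - D (Suc k)) * tri (min h k)) =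
     (\<Sum>k<n. D (Suc k) * (tri (min h (Suc k)) - tri (min h k))) - D (Suc n) * tri (min h n)" for n h
    by (induction n) (auto simp: tri_def algebra_simps)
  have tele: "(\<Sum>k<n. D (Suc k) * (tri (min h (Suc k)) - tri (min h k))) = F (min n h)"
    if "n \<le> H" for n h
    using that
  proof (induction n)
    case 0
    then show ?case by (simp add: F_def)
  next
    case (Suc n)
    then have "D (Suc n) * (if Suc n \<le> h then real (Suc n) else 0) = F (min (Suc n) h) - F (min n h)"
    proof (cases "Suc n \<le> h")
      case True
      then show ?thesis using Suc.prems by (simp add: D_def min_def)
    next
      case False
      then have "min (Suc n) h = min n h" by simp
      then show ?thesis using False by simp
    qed
    then show ?case using Suc by (simp only: tri_min_diff sum.lessThan_Suc)
  qed
  show ?thesis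
  proof (intro exI[of _ "\<lambda>k. D k - D (Suc k)"] ballI)
    fix h assume "h \<in> {1..H}"
    then show "(\<Sum>k=1..H. (D k - D (Suc k)) * tri (min h k)) = f h"
      using parts[of h H] tele[OF order_refl, of h] by (simp add: D_def[of "Suc H"] F_def)
  qed
qed

section \<open>Prescribing the differences of the measures\<close>

theorem theorem5:
  fixes n H :: nat and m :: "nat \<Rightarrow> nat \<Rightarrow> int" and \<theta> :: real
  assumes "n \<ge> 2" and "H \<ge> 2" and "\<theta> > 0"
  shows "\<exists>A :: nat \<Rightarrow> real set.
    (\<forall>i\<in>{1..n}. A i \<in> sets lebesgue) \<and>
    (\<forall>i\<in>{1..n}. \<forall>h\<in>{1..H}.
       hfold_sumset h (A i) \<in> sets lebesgue \<and> emeasure lebesgue (hfold_sumset h (A i)) < \<infinity>) \<and>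
    (\<forall>i\<in>{1..n-1}. \<forall>h\<in>{1..H}.
       measure lebesgue (hfold_sumset h (A i)) - measure lebesgue (hfold_sumset h (A (i + 1)))
         = \<theta> * of_int (m i h))"
proof -
  \<comment> \<open>Negated partial sums, so that f i h - f (i + 1) h = \<theta> * m i h for i >=
    1.\<close>
  define f where "f i h = - (\<theta> * (\<Sum>i'=1..<i. of_int (m i' h)))" for i h
  have "\<forall>i. \<exists>u. \<forall>h\<in>{1..H}. (\<Sum>k=1..H. u k * tri (min h k)) = f i h"
    using tri_min_span by blast
  then obtain u where u: "\<And>i h. h \<in> {1..H} \<Longrightarrow> (\<Sum>k=1..H. u i k * tri (min h k)) = f i h"
    by metis
  \<comment> \<open>A common bound for all parameters, so that a single c serves every i and cancels
    in the differences.\<close>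
  define U where "U = (\<Sum>(i, k)\<in>{1..n} \<times> {1..H}. \<bar>u i k\<bar>)"
  have U0: "0 \<le> U" unfolding U_def by (intro sum_nonneg) auto
  have uU: "\<bar>u i k\<bar> \<le> U" if "i \<in> {1..n}" "k \<in> {1..H}" for i k
    unfolding U_def using that
    by (intro member_le_sum[of "(i, k)" _ "\<lambda>(i, k). \<bar>u i k\<bar>", simplified]) auto
  obtain c t where ct: "\<And>u. (\<forall>k\<in>{1..H}. \<bar>u k\<bar> \<le> U) \<Longrightarrow>
    (\<exists>A. A \<subseteq> {0..t} \<and> 0 \<in> A \<and> t \<in> A \<and>
      (\<forall>h\<in>{1..H}. hfold_sumset h A \<in> lmeasurable \<and>
        measure lebesgue (hfold_sumset h A) = c h + (\<Sum>k=1..H. u k * tri (min h k))))"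
    using exists_sets_with_affine_sumset_measures[OF U0, of H H] by blast
  have "\<forall>i\<in>{1..n}. \<exists>A. \<forall>h\<in>{1..H}. hfold_sumset h A \<in> lmeasurable \<and>
      measure lebesgue (hfold_sumset h A) = c h + f i h"
  proof
    fix i assume "i \<in> {1..n}"
    then show "\<exists>A. \<forall>h\<in>{1..H}. hfold_sumset h A \<in> lmeasurable \<and>
        measure lebesgue (hfold_sumset h A) = c h + f i h"
      using ct[of "u i"] uU u[of _ i] by fastforce
  qed
  then obtain A where A: "\<And>i h. i \<in> {1..n} \<Longrightarrow> h \<in> {1..H} \<Longrightarrow> hfold_sumset h (A i) \<in> lmeasurable \<and>
      measure lebesgue (hfold_sumset h (A i)) = c h + f i h"
    by metis
  show ?thesis
  proof (intro exI[of _ A] conjI ballI)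
    fix i assume i: "i \<in> {1..n}"
    show "A i \<in> sets lebesgue"
      \<comment> \<open>Measurability of \<open>A i\<close> itself is the case h = 1.\<close>
      using A[OF i, of 1] assms(2) unfolding hfold_sumset_one by auto
    fix h assume h: "h \<in> {1..H}"
    show "hfold_sumset h (A i) \<in> sets lebesgue" "emeasure lebesgue (hfold_sumset h (A i)) < \<infinity>"
      using A[OF i h] by (auto simp: fmeasurable_def)
  next
    fix i h assume i: "i \<in> {1..n - 1}" and h: "h \<in> {1..H}"
    have "i \<in> {1..n}" "i + 1 \<in> {1..n}" using i by auto
    then show "measure lebesgue (hfold_sumset h (A i)) - measure lebesgue (hfold_sumset h (A (i + 1)))
         = \<theta> * of_int (m i h)"
      using A[of i h] A[of "i + 1" h] h i by (simp add: f_def algebra_simps)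
  qed
qed

end
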